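(* If $T$ is a leafless tree, then $Sib(T)=1$ or $Sib(T)=\infty$.
   Context: A tree is a connected acyclic simple graph, of arbitrary cardinality. A leaf is a vertex of degree $1$; a tree is leafless if it has no leaf. An embedding from a tree $T$ to a tree $S$ is an injective map $V(T)\to V(S)$ preserving adjacency. Two trees are siblings if each embeds in the other. $Sib(T)$ is the number of isomorphism classes of trees that are siblings of $T$; the siblings are arbitrary trees (not required to be leafless). $Sib(T)=\infty$ means that this number is infinite. *)

theory Defs
  imports Main "HOL-Library.Extended_Nat"
begin

section \<open>Simple graphs and trees of arbitrary cardinality\<close>

record 'a ugraph =
  verts :: "'a set"
  adj :: "'a \<Rightarrow> 'a \<Rightarrow> bool"

definition simple_graph :: "'a ugraph \<Rightarrow> bool" where
  "simple_graph G \<longleftrightarrow>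
     (\<forall>u v. adj G u v \<longrightarrow> u \<in> verts G \<and> v \<in> verts G \<and> u \<noteq> v \<and> adj G v u)"

definition connected_graph :: "'a ugraph \<Rightarrow> bool" where
  "connected_graph G \<longleftrightarrow>
     verts G \<noteq> {} \<and> (\<forall>u\<in>verts G. \<forall>v\<in>verts G. (adj G)\<^sup>*\<^sup>* u v)"

text \<open>A cycle is listed without repeating its first vertex at the end.\<close>

definition is_cycle :: "'a ugraph \<Rightarrow> 'a list \<Rightarrow> bool" where
  "is_cycle G xs \<longleftrightarrow>
     length xs \<ge> 3 \<and> distinct xs \<and> successively (adj G) xs \<and> adj G (last xs) (hd xs)"

definition acyclic_graph :: "'a ugraph \<Rightarrow> bool" where
  "acyclic_graph G \<longleftrightarrow> (\<nexists>xs. is_cycle G xs)"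

definition tree :: "'a ugraph \<Rightarrow> bool" where
  "tree G \<longleftrightarrow> simple_graph G \<and> connected_graph G \<and> acyclic_graph G"

text \<open>Vertices of infinite degree cause no confusion here: \<open>card\<close> is \<open>0\<close> on infinite
  sets, so they are not leaves.  The one-vertex tree is leafless.\<close>

definition is_leaf :: "'a ugraph \<Rightarrow> 'a \<Rightarrow> bool" where
  "is_leaf G v \<longleftrightarrow> v \<in> verts G \<and> card {u. adj G v u} = 1"

definition leafless :: "'a ugraph \<Rightarrow> bool" where
  "leafless G \<longleftrightarrow> (\<nexists>v. is_leaf G v)"

section \<open>Embeddings, isomorphisms and siblings\<close>

definition graph_embedding :: "'a ugraph \<Rightarrow> 'b ugraph \<Rightarrow> ('a \<Rightarrow> 'b) \<Rightarrow> bool" where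
  "graph_embedding G H f \<longleftrightarrow>
     f ` verts G \<subseteq> verts H \<and> inj_on f (verts G) \<and>
     (\<forall>u\<in>verts G. \<forall>v\<in>verts G. adj G u v \<longrightarrow> adj H (f u) (f v))"

definition embeds :: "'a ugraph \<Rightarrow> 'b ugraph \<Rightarrow> bool" where
  "embeds G H \<longleftrightarrow> (\<exists>f. graph_embedding G H f)"

definition isomorphic :: "'a ugraph \<Rightarrow> 'b ugraph \<Rightarrow> bool" where
  "isomorphic G H \<longleftrightarrow>
     (\<exists>f. bij_betw f (verts G) (verts H) \<and>
          (\<forall>u\<in>verts G. \<forall>v\<in>verts G. adj G u v \<longleftrightarrow> adj H (f u) (f v)))"

definition siblings :: "'a ugraph \<Rightarrow> 'b ugraph \<Rightarrow> bool" where
  "siblings S T \<longleftrightarrow> embeds S T \<and> embeds T S"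

text \<open>Only siblings whose vertices lie in the vertex type of \<open>T\<close> are collected.  This loses
  no isomorphism class, whatever the type of the vertices of the sibling: see
  \<open>sibling_copy\<close> below.\<close>

definition sibling_trees :: "'a ugraph \<Rightarrow> 'a ugraph set" where
  "sibling_trees T = {S. tree S \<and> siblings S T}"

definition sibling_iso :: "'a ugraph \<Rightarrow> 'a ugraph rel" where
  "sibling_iso T =
     {(S, S'). S \<in> sibling_trees T \<and> S' \<in> sibling_trees T \<and> isomorphic S S'}"

definition Sib :: "'a ugraph \<Rightarrow> enat" where
  "Sib T =
     (let C = sibling_trees T // sibling_iso T
      in if finite C then enat (card C) else \<infinity>)"

section \<open>Adequacy of the definition of the number of siblings\<close>

lemma isomorphic_refl: "isomorphic G G"
  unfolding isomorphic_def by (rule exI[of _ id]) auto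

lemma isomorphic_sym:
  assumes "isomorphic G H"
  shows "isomorphic H G"
proof -
  obtain f where f: "bij_betw f (verts G) (verts H)"
    and a: "\<forall>u\<in>verts G. \<forall>v\<in>verts G. adj G u v \<longleftrightarrow> adj H (f u) (f v)"
    using assms unfolding isomorphic_def by blast
  let ?g = "inv_into (verts G) f"
  have g: "bij_betw ?g (verts H) (verts G)"
    by (rule bij_betw_inv_into[OF f])
  have "adj H u v \<longleftrightarrow> adj G (?g u) (?g v)" if "u \<in> verts H" "v \<in> verts H" for u v
    using a that bij_betw_apply[OF g] bij_betw_inv_into_right[OF f] by metis
  with g show ?thesis unfolding isomorphic_def by blast
qed

lemma isomorphic_trans:
  assumes "isomorphic G H" "isomorphic H K"
  shows "isomorphic G K"
proof -
  obtain f where f: "bij_betw f (verts G) (verts H)"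
    and a: "\<forall>u\<in>verts G. \<forall>v\<in>verts G. adj G u v \<longleftrightarrow> adj H (f u) (f v)"
    using assms unfolding isomorphic_def by blast
  obtain g where g: "bij_betw g (verts H) (verts K)"
    and b: "\<forall>u\<in>verts H. \<forall>v\<in>verts H. adj H u v \<longleftrightarrow> adj K (g u) (g v)"
    using assms unfolding isomorphic_def by blast
  have "bij_betw (g \<circ> f) (verts G) (verts K)"
    using f g by (rule bij_betw_trans)
  moreover have "adj G u v \<longleftrightarrow> adj K ((g \<circ> f) u) ((g \<circ> f) v)"
    if "u \<in> verts G" "v \<in> verts G" for u v
    using a b that bij_betw_apply[OF f] by simp
  ultimately show ?thesis unfolding isomorphic_def by blast
qed

lemma equiv_sibling_iso: "equiv (sibling_trees T) (sibling_iso T)"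
proof (rule equivI)
  show "sibling_iso T \<subseteq> sibling_trees T \<times> sibling_trees T"
    unfolding sibling_iso_def by blast
  show "refl_on (sibling_trees T) (sibling_iso T)"
    unfolding refl_on_def sibling_iso_def using isomorphic_refl by blast
  show "sym (sibling_iso T)"
    unfolding sym_def sibling_iso_def using isomorphic_sym by blast
  show "trans (sibling_iso T)"
    unfolding trans_def sibling_iso_def using isomorphic_trans by blast
qed

lemma embeds_trans:
  assumes "embeds G H" "embeds H K"
  shows "embeds G K"
proof -
  obtain f g where "graph_embedding G H f" "graph_embedding H K g"
    using assms unfolding embeds_def by blast
  then have f: "f ` verts G \<subseteq> verts H" "inj_on f (verts G)"
      "\<forall>u\<in>verts G. \<forall>v\<in>verts G. adj G u v \<longrightarrow> adj H (f u) (f v)"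
    and g: "g ` verts H \<subseteq> verts K" "inj_on g (verts H)"
      "\<forall>u\<in>verts H. \<forall>v\<in>verts H. adj H u v \<longrightarrow> adj K (g u) (g v)"
    unfolding graph_embedding_def by blast+
  have "inj_on (g \<circ> f) (verts G)"
    using f(2) inj_on_subset[OF g(2) f(1)] by (rule comp_inj_on)
  moreover have "(g \<circ> f) ` verts G \<subseteq> verts K"
    using f(1) g(1) by auto
  moreover have "adj K ((g \<circ> f) u) ((g \<circ> f) v)"
    if "u \<in> verts G" "v \<in> verts G" "adj G u v" for u v
    using that f(1,3) g(3) by (simp add: image_subset_iff)
  ultimately have "graph_embedding G K (g \<circ> f)"
    unfolding graph_embedding_def by blast
  then show ?thesis unfolding embeds_def by blast
qed

lemma isomorphic_imp_embeds:
  assumes "isomorphic G H"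
  shows "embeds G H"
proof -
  obtain f where "bij_betw f (verts G) (verts H)"
    and "\<forall>u\<in>verts G. \<forall>v\<in>verts G. adj G u v \<longleftrightarrow> adj H (f u) (f v)"
    using assms unfolding isomorphic_def by blast
  then have "graph_embedding G H f"
    unfolding graph_embedding_def bij_betw_def by simp
  then show ?thesis unfolding embeds_def by blast
qed

lemma tree_isomorphic:
  assumes "tree G" "simple_graph H" "isomorphic G H"
  shows "tree H"
proof -
  obtain g where g: "bij_betw g (verts H) (verts G)"
    and b: "\<forall>u\<in>verts H. \<forall>v\<in>verts H. adj H u v \<longleftrightarrow> adj G (g u) (g v)"
    using isomorphic_sym[OF assms(3)] unfolding isomorphic_def by blast
  let ?f = "inv_into (verts H) g"
  have f: "bij_betw ?f (verts G) (verts H)" by (rule bij_betw_inv_into[OF g])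
  have gf: "g (?f u) = u" "?f u \<in> verts H" if "u \<in> verts G" for u
    using that bij_betw_inv_into_right[OF g] bij_betw_apply[OF f] by auto
  have G: "u \<in> verts G \<and> v \<in> verts G" if "adj G u v" for u v
    using that assms(1) unfolding tree_def simple_graph_def by blast
  have H: "u \<in> verts H \<and> v \<in> verts H" if "adj H u v" for u v
    using that assms(2) unfolding simple_graph_def by blast
  have step: "adj H (?f u) (?f v)" if "adj G u v" for u v
    using that G b gf by metis
  have path: "(adj H)\<^sup>*\<^sup>* (?f u) (?f v)" if "(adj G)\<^sup>*\<^sup>* u v" for u v
    using that by (induction) (auto intro: rtranclp.rtrancl_into_rtrancl step)
  have "connected_graph H"
    unfolding connected_graph_def
  proof (intro conjI ballI)
    show "verts H \<noteq> {}"
      using assms(1) f unfolding tree_def connected_graph_def bij_betw_def by auto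
    fix u v assume uv: "u \<in> verts H" "v \<in> verts H"
    then have "(adj G)\<^sup>*\<^sup>* (g u) (g v)"
      using assms(1) bij_betw_apply[OF g] unfolding tree_def connected_graph_def by blast
    from path[OF this] show "(adj H)\<^sup>*\<^sup>* u v"
      using uv bij_betw_inv_into_left[OF g] by simp
  qed
  moreover have "acyclic_graph H"
    unfolding acyclic_graph_def
  proof
    assume "\<exists>xs. is_cycle H xs"
    then obtain xs where xs: "length xs \<ge> 3" "distinct xs" "successively (adj H) xs"
      "adj H (last xs) (hd xs)"
      unfolding is_cycle_def by blast
    have ne: "xs \<noteq> []" using xs(1) by auto
    have V: "set xs \<subseteq> verts H"
    proof -
      have "set ys \<subseteq> verts H" if "successively (adj H) ys" "last ys \<in> verts H" for ys
        using that by (induction ys rule: induct_list012) (auto dest: H)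
      with xs H show ?thesis by blast
    qed
    have "successively (adj G) (map g xs)"
      unfolding successively_map
      by (rule successively_mono[OF xs(3)]) (use b H in blast)
    moreover have "distinct (map g xs)"
      using xs(2) V g inj_on_subset unfolding bij_betw_def distinct_map by blast
    moreover have "adj G (last (map g xs)) (hd (map g xs))"
      using ne b H[OF xs(4)] xs(4) by (simp add: last_map hd_map)
    ultimately have "is_cycle G (map g xs)"
      using xs(1) unfolding is_cycle_def by simp
    then show False using assms(1) unfolding tree_def acyclic_graph_def by blast
  qed
  ultimately show ?thesis using assms(2) unfolding tree_def by blast
qed

lemma sibling_copy:
  fixes T :: "'a ugraph" and S :: "'b ugraph"
  assumes "tree T" "tree S" "siblings S T"
  shows "\<exists>S' \<in> sibling_trees T. isomorphic S S'"
proof -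
  obtain f :: "'b \<Rightarrow> 'a" where inj: "inj_on f (verts S)"
    using assms(3) unfolding siblings_def embeds_def graph_embedding_def by blast
  define S' :: "'a ugraph" where
    "S' = \<lparr> verts = f ` verts S,
            adj = (\<lambda>x y. \<exists>u\<in>verts S. \<exists>v\<in>verts S. x = f u \<and> y = f v \<and> adj S u v) \<rparr>"
  have "simple_graph S'"
    unfolding simple_graph_def
  proof (intro allI impI)
    fix x y assume "adj S' x y"
    then obtain u v where uv: "u \<in> verts S" "v \<in> verts S" "x = f u" "y = f v" "adj S u v"
      unfolding S'_def by auto
    moreover have "u \<noteq> v" "adj S v u"
      using uv(5) assms(2) unfolding tree_def simple_graph_def by blast+
    ultimately show "x \<in> verts S' \<and> y \<in> verts S' \<and> x \<noteq> y \<and> adj S' y x"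
      using inj_onD[OF inj] unfolding S'_def by auto
  qed
  moreover have iso: "isomorphic S S'"
    unfolding isomorphic_def S'_def
    by (rule exI[of _ f]) (use inj in \<open>auto simp: bij_betw_def dest: inj_onD\<close>)
  ultimately have "tree S'" using tree_isomorphic assms(2) by blast
  moreover have "siblings S' T"
    using assms(3) iso unfolding siblings_def
    by (meson embeds_trans isomorphic_imp_embeds isomorphic_sym)
  ultimately show ?thesis using iso unfolding sibling_trees_def by blast
qed

end

theory Submission
  imports Defs
begin

text \<open>
  The dichotomy is decided by whether \<open>T\<close> has a self-embedding that misses a vertex.

  An embedding of a connected graph into a tree reflects adjacency, since an extra edge in
  the target would close a cycle (\<open>embedding_reflects_adj\<close>).  Hence an embedding between
  trees that hits every vertex is an isomorphism.  If every self-embedding of \<open>T\<close> is onto,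
  then for a sibling \<open>S\<close> the composite \<open>T \<rightarrow> S \<rightarrow> T\<close> is onto, so \<open>S \<rightarrow> T\<close> is onto and \<open>S\<close> is
  isomorphic to \<open>T\<close>; there is one sibling.

  If some self-embedding \<open>f\<close> misses a vertex, every sibling \<open>S\<close> has a copy in \<open>T\<close> that misses
  a vertex: embed \<open>S\<close> in \<open>T\<close> and apply \<open>f\<close>.  By connectedness some missed vertex is
  adjacent to the copy, and adding it as a pendant vertex gives a new sibling.  Repeating
  this from \<open>T\<close> gives siblings that are \<open>T\<close> with \<open>n\<close> vertices added, one after the other.
  They are told apart by the number of vertices outside the core, the largest
  vertex set inducing minimum degree at least two.  A pendant vertex never belongs to
  the core and adding it does not change the core, so each step raises this number by one
  (\<open>larger_sibling\<close>).  It starts from \<open>0\<close> because \<open>T\<close>, being leafless and having more than one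
  vertex, is its own core.
\<close>

section \<open>Paths and embeddings in trees\<close>

lemma distinct_path:
  assumes "r\<^sup>*\<^sup>* u v"
  shows "\<exists>xs. xs \<noteq> [] \<and> hd xs = u \<and> last xs = v \<and> distinct xs \<and> successively r xs"
  using assms
proof induction
  case base
  show ?case by (rule exI[of _ "[u]"]) simp
next
  case (step y z)
  then obtain xs where xs: "xs \<noteq> []" "hd xs = u" "last xs = y" "distinct xs" "successively r xs"
    by blast
  show ?case
  proof (cases "z \<in> set xs")
    case True
    \<comment> \<open>The path already meets \<open>z\<close>, so it is cut off there.\<close>
    then obtain ys zs where "xs = ys @ z # zs" by (meson split_list)
    then have "hd (ys @ [z]) = u" "distinct (ys @ [z])" "successively r (ys @ [z])"
      using xs by (auto simp: successively_append_iff successively_Cons hd_append)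
    then show ?thesis by (intro exI[of _ "ys @ [z]"]) simp
  next
    case False
    then show ?thesis
      using xs step by (intro exI[of _ "xs @ [z]"]) (simp add: successively_append_iff)
  qed
qed

lemma adj_verts:
  assumes "simple_graph G" "adj G u v"
  shows "u \<in> verts G" "v \<in> verts G"
  using assms unfolding simple_graph_def by blast+

lemma path_in_verts:
  assumes "simple_graph G" "successively (adj G) xs" "xs \<noteq> []" "hd xs \<in> verts G"
  shows "set xs \<subseteq> verts G"
  using assms(2-4)
  by (induction xs rule: induct_list012) (auto dest: adj_verts[OF assms(1)])

lemma embedding_path:
  assumes "graph_embedding G H f" "simple_graph G"
    and "successively (adj G) xs" "distinct xs" "set xs \<subseteq> verts G"
  shows "successively (adj H) (map f xs)" "distinct (map f xs)"
proof -
  show "successively (adj H) (map f xs)"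
    unfolding successively_map
    by (rule successively_mono[OF assms(3)])
      (use assms(1) adj_verts[OF assms(2)] in \<open>auto simp: graph_embedding_def\<close>)
  show "distinct (map f xs)"
    using assms unfolding graph_embedding_def distinct_map by (meson inj_on_subset)
qed

text \<open>Two non-adjacent vertices are joined by a path with an inner vertex; an edge between
  their images would close the image of this path to a cycle.\<close>

lemma embedding_reflects_adj:
  assumes f: "graph_embedding G H f"
    and G: "simple_graph G" "connected_graph G" and H: "simple_graph H" "acyclic_graph H"
    and uv: "u \<in> verts G" "v \<in> verts G" "adj H (f u) (f v)"
  shows "adj G u v"
proof (rule ccontr)
  assume not_adj: "\<not> adj G u v"
  have "(adj G)\<^sup>*\<^sup>* u v" using G(2) uv unfolding connected_graph_def by blast
  then obtain xs where xs: "xs \<noteq> []" "hd xs = u" "last xs = v" "distinct xs"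
    "successively (adj G) xs"
    using distinct_path by metis
  have "u \<noteq> v" and closing: "adj H (f v) (f u)" using uv(3) H(1) unfolding simple_graph_def by blast+
  have "length xs \<ge> 3"
  proof (rule ccontr)
    assume "\<not> length xs \<ge> 3"
    then have "xs = [u] \<or> xs = [u, v]"
      using xs(1-3) by (cases xs rule: remdups_adj.cases) (auto simp: Suc_le_eq split: if_splits)
    then show False using xs(3,5) \<open>u \<noteq> v\<close> not_adj by (elim disjE) simp_all
  qed
  moreover have "set xs \<subseteq> verts G" using path_in_verts[OF G(1) xs(5,1)] xs(2) uv(1) by simp
  ultimately have "is_cycle H (map f xs)"
    using embedding_path[OF f G(1) xs(5,4)] closing xs(1-3)
    unfolding is_cycle_def by (simp add: last_map hd_map)
  then show False using H(2) unfolding acyclic_graph_def by blast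
qed

lemma onto_embedding_isomorphic:
  assumes "tree G" "tree H" "graph_embedding G H f" "f ` verts G = verts H"
  shows "isomorphic G H"
  unfolding isomorphic_def
proof (intro exI[of _ f] conjI ballI)
  show "bij_betw f (verts G) (verts H)"
    using assms(3,4) unfolding graph_embedding_def bij_betw_def by blast
  fix u v assume "u \<in> verts G" "v \<in> verts G"
  then show "adj G u v \<longleftrightarrow> adj H (f u) (f v)"
    using assms embedding_reflects_adj[OF assms(3)] unfolding tree_def graph_embedding_def by blast
qed

lemma graph_embedding_comp:
  assumes "graph_embedding G H f" "graph_embedding H K g"
  shows "graph_embedding G K (g \<circ> f)"
  using assms unfolding graph_embedding_def
  by (auto simp: image_subset_iff intro: comp_inj_on inj_on_subset)

section \<open>Induced subgraphs and pendant vertices\<close>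

definition induced :: "'a ugraph \<Rightarrow> 'a set \<Rightarrow> 'a ugraph" where
  "induced G X = \<lparr>verts = X, adj = (\<lambda>u v. u \<in> X \<and> v \<in> X \<and> adj G u v)\<rparr>"

lemma induced_simps [simp]:
  "verts (induced G X) = X"
  "adj (induced G X) u v \<longleftrightarrow> u \<in> X \<and> v \<in> X \<and> adj G u v"
  by (simp_all add: induced_def)

lemma induced_simple: "simple_graph G \<Longrightarrow> simple_graph (induced G X)"
  unfolding simple_graph_def by auto

lemma induced_acyclic:
  assumes "acyclic_graph G"
  shows "acyclic_graph (induced G X)"
proof -
  have "is_cycle G xs" if "is_cycle (induced G X) xs" for xs
    using that unfolding is_cycle_def by (auto elim: successively_mono)
  then show ?thesis using assms unfolding acyclic_graph_def by blast
qed

lemma induced_image_isomorphic: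
  assumes "tree S" "tree T" "graph_embedding S T e"
  shows "isomorphic S (induced T (e ` verts S))"
  unfolding isomorphic_def
proof (intro exI[of _ e] conjI ballI)
  show "bij_betw e (verts S) (verts (induced T (e ` verts S)))"
    using assms(3) unfolding graph_embedding_def bij_betw_def by simp
  fix u v assume "u \<in> verts S" "v \<in> verts S"
  then show "adj S u v \<longleftrightarrow> adj (induced T (e ` verts S)) (e u) (e v)"
    using assms embedding_reflects_adj[OF assms(3)] unfolding tree_def graph_embedding_def by auto
qed

lemma boundary_edge:
  assumes "connected_graph G" "X \<noteq> {}" "X \<subset> verts G"
  shows "\<exists>x\<in>X. \<exists>w. w \<notin> X \<and> adj G x w"
proof (rule ccontr)
  assume none: "\<not> ?thesis"
  obtain x w where xw: "x \<in> X" "w \<in> verts G" "w \<notin> X" using assms by blast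
  then have "(adj G)\<^sup>*\<^sup>* x w" using assms unfolding connected_graph_def by blast
  then have "w \<in> X" by induction (use xw none in auto)
  with xw show False by blast
qed

text \<open>Two neighbours of \<open>w\<close> in a connected set avoiding \<open>w\<close> would give a cycle through \<open>w\<close>.\<close>

lemma one_neighbour_in_connected_set:
  assumes G: "simple_graph G" "acyclic_graph G" and X: "connected_graph (induced G X)"
    and w: "w \<notin> X" and ab: "a \<in> X" "b \<in> X" "adj G w a" "adj G w b"
  shows "a = b"
proof (rule ccontr)
  assume "a \<noteq> b"
  have "(adj (induced G X))\<^sup>*\<^sup>* a b" using X ab unfolding connected_graph_def by simp
  then obtain xs where xs: "xs \<noteq> []" "hd xs = a" "last xs = b" "distinct xs"
    "successively (adj (induced G X)) xs"
    using distinct_path by metis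
  have sub: "set xs \<subseteq> X"
    using path_in_verts[OF induced_simple[OF G(1)] xs(5,1)] xs(2) ab(1) by simp
  have "successively (adj G) xs" by (rule successively_mono[OF xs(5)]) simp
  then have "successively (adj G) (w # xs)" using xs ab by (simp add: successively_Cons)
  moreover have "length xs \<ge> 2" using xs \<open>a \<noteq> b\<close> by (cases xs rule: remdups_adj.cases) auto
  moreover have "adj G b w" using ab G(1) unfolding simple_graph_def by blast
  ultimately have "is_cycle G (w # xs)"
    using xs sub w unfolding is_cycle_def by auto
  then show False using G(2) unfolding acyclic_graph_def by blast
qed

lemma pendant_connected:
  assumes G: "simple_graph G" and X: "connected_graph (induced G X)" and x: "x \<in> X" "adj G x w"
  shows "connected_graph (induced G (insert w X))"
proof -
  let ?r = "(adj (induced G (insert w X)))\<^sup>*\<^sup>*"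
  have "?r u v" if "u \<in> X" "v \<in> X" for u v
  proof -
    have "(adj (induced G X))\<^sup>*\<^sup>* u v" using X that unfolding connected_graph_def by simp
    then show ?thesis by (rule rtranclp_mono[THEN predicate2D, rotated]) auto
  qed
  moreover have "?r x w" "?r w x"
    using x G unfolding simple_graph_def by (auto intro!: r_into_rtranclp)
  ultimately have "?r u x" "?r x u" if "u \<in> insert w X" for u using that x by auto
  then show ?thesis unfolding connected_graph_def by (auto intro: rtranclp_trans)
qed

section \<open>The core as an isomorphism invariant\<close>

definition min_degree_two :: "'a ugraph \<Rightarrow> 'a set \<Rightarrow> bool" where
  "min_degree_two G Z \<longleftrightarrow>
     Z \<subseteq> verts G \<and> (\<forall>z\<in>Z. \<exists>a\<in>Z. \<exists>b\<in>Z. a \<noteq> b \<and> adj G z a \<and> adj G z b)"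

definition core :: "'a ugraph \<Rightarrow> 'a set" where
  "core G = \<Union>{Z. min_degree_two G Z}"

lemma core_subset: "core G \<subseteq> verts G"
  unfolding core_def min_degree_two_def by blast

lemma embedding_core:
  assumes f: "graph_embedding G H f"
  shows "f ` core G \<subseteq> core H"
proof -
  have "min_degree_two H (f ` Z)" if Z: "min_degree_two G Z" for Z
  proof -
    have "\<exists>a\<in>f ` Z. \<exists>b\<in>f ` Z. a \<noteq> b \<and> adj H (f z) a \<and> adj H (f z) b" if z: "z \<in> Z" for z
    proof -
      obtain a b where ab: "a \<in> Z" "b \<in> Z" "a \<noteq> b" "adj G z a" "adj G z b"
        using Z z unfolding min_degree_two_def by blast
      moreover have "z \<in> verts G" "a \<in> verts G" "b \<in> verts G"
        using Z z ab unfolding min_degree_two_def by blast+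
      ultimately show ?thesis
        using f unfolding graph_embedding_def by (meson image_eqI inj_onD)
    qed
    then show ?thesis using Z f unfolding min_degree_two_def graph_embedding_def by blast
  qed
  then show ?thesis unfolding core_def by blast
qed

lemma isomorphic_outside_core:
  assumes "isomorphic G H"
  shows "\<exists>f. bij_betw f (verts G - core G) (verts H - core H)"
proof -
  obtain f where f: "bij_betw f (verts G) (verts H)"
    and a: "\<forall>u\<in>verts G. \<forall>v\<in>verts G. adj G u v \<longleftrightarrow> adj H (f u) (f v)"
    using assms unfolding isomorphic_def by blast
  let ?g = "inv_into (verts G) f"
  have g: "bij_betw ?g (verts H) (verts G)" by (rule bij_betw_inv_into[OF f])
  have fg: "f (?g y) = y" if "y \<in> verts H" for y using bij_betw_inv_into_right[OF f that] .
  have "graph_embedding G H f" using f a unfolding graph_embedding_def bij_betw_def by simp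
  from embedding_core[OF this] have 1: "f ` core G \<subseteq> core H" .
  have "adj G (?g u) (?g v)" if "u \<in> verts H" "v \<in> verts H" "adj H u v" for u v
    using that a fg bij_betw_apply[OF g] by metis
  then have "graph_embedding H G ?g" using g unfolding graph_embedding_def bij_betw_def by simp
  from embedding_core[OF this] have 2: "core H \<subseteq> f ` core G"
    using fg core_subset[of H] by (metis image_subset_iff rev_image_eqI subsetD subsetI)
  have "f ` (verts G - core G) = f ` verts G - f ` core G"
    using f core_subset[of G] unfolding bij_betw_def by (meson inj_on_image_set_diff Diff_subset)
  then have "f ` (verts G - core G) = verts H - core H"
    using 1 2 f unfolding bij_betw_def by simp
  then show ?thesis
    using f unfolding bij_betw_def by (meson inj_on_subset Diff_subset)
qed

lemma core_leafless:
  assumes "tree T" "leafless T" and nontrivial: "\<not> (\<exists>v. verts T \<subseteq> {v})"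
  shows "core T = verts T"
proof -
  have "\<exists>a\<in>verts T. \<exists>b\<in>verts T. a \<noteq> b \<and> adj T z a \<and> adj T z b" if z: "z \<in> verts T" for z
  proof -
    have "{z} \<subset> verts T" using nontrivial z by blast
    then obtain a where a: "adj T z a"
      using boundary_edge[of T "{z}"] assms(1) unfolding tree_def by auto
    have "card {u. adj T z u} \<noteq> 1" using assms(2) z unfolding leafless_def is_leaf_def by blast
    then have "{u. adj T z u} \<noteq> {a}" by auto
    then obtain b where "adj T z b" "a \<noteq> b" using a by blast
    then show ?thesis using a assms(1) adj_verts unfolding tree_def by metis
  qed
  then have "min_degree_two T (verts T)" unfolding min_degree_two_def by blast
  then have "verts T \<subseteq> core T" unfolding core_def by blast
  then show ?thesis using core_subset by (metis subset_antisym)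
qed

text \<open>A set of minimum degree two cannot contain a pendant vertex, so it lies in \<open>X\<close>.\<close>

lemma core_pendant:
  assumes G: "simple_graph G" "acyclic_graph G" and X: "connected_graph (induced G X)"
    and w: "w \<notin> X"
  shows "core (induced G (insert w X)) = core (induced G X)"
proof -
  have "min_degree_two (induced G (insert w X)) Z \<longleftrightarrow> min_degree_two (induced G X) Z" for Z
  proof
    assume Z: "min_degree_two (induced G (insert w X)) Z"
    have "w \<notin> Z"
    proof
      assume "w \<in> Z"
      then obtain a b where ab: "a \<noteq> b" "a \<in> insert w X" "b \<in> insert w X" "adj G w a" "adj G w b"
        using Z unfolding min_degree_two_def by auto
      then have "a \<in> X" "b \<in> X" using G(1) unfolding simple_graph_def by blast+
      then show False using one_neighbour_in_connected_set[OF G X w] ab by blast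
    qed
    then show "min_degree_two (induced G X) Z"
      using Z unfolding min_degree_two_def by (simp add: subset_insert) blast
  next
    assume "min_degree_two (induced G X) Z"
    then show "min_degree_two (induced G (insert w X)) Z"
      unfolding min_degree_two_def by auto blast
  qed
  then show ?thesis unfolding core_def by auto
qed

section \<open>Trees with a self-embedding that misses a vertex\<close>

text \<open>The sibling is embedded in \<open>T\<close> through \<open>f\<close>, which leaves room for one more vertex.\<close>

lemma larger_sibling:
  assumes T: "tree T" and f: "graph_embedding T T f" "f ` verts T \<noteq> verts T"
    and S: "S \<in> sibling_trees T" "finite (verts S - core S)"
  shows "\<exists>S'\<in>sibling_trees T. finite (verts S' - core S') \<and>
           card (verts S' - core S') = Suc (card (verts S - core S))"
proof -
  have tS: "tree S" using S unfolding sibling_trees_def by blast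
  have T': "simple_graph T" "connected_graph T" "acyclic_graph T"
    using T unfolding tree_def by blast+
  obtain g where g: "graph_embedding S T g"
    using S unfolding sibling_trees_def siblings_def embeds_def by blast
  define X where "X = (f \<circ> g) ` verts S"
  have fg: "graph_embedding S T (f \<circ> g)" by (rule graph_embedding_comp[OF g f(1)])
  have iso: "isomorphic S (induced T X)"
    unfolding X_def by (rule induced_image_isomorphic[OF tS T fg])
  have tX: "tree (induced T X)"
    using tree_isomorphic[OF tS induced_simple[OF T'(1)] iso] .
  have "X \<noteq> {}" using tX unfolding tree_def connected_graph_def by simp
  moreover have "X \<subset> verts T"
  proof -
    have "g ` verts S \<subseteq> verts T" using g unfolding graph_embedding_def by blast
    then have "X \<subseteq> f ` verts T" unfolding X_def by (auto simp: image_comp [symmetric])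
    moreover have "f ` verts T \<subset> verts T" using f unfolding graph_embedding_def by blast
    ultimately show ?thesis by blast
  qed
  ultimately obtain x w where xw: "x \<in> X" "w \<notin> X" "adj T x w"
    using boundary_edge T'(2) by metis
  define S' where "S' = induced T (insert w X)"
  have cX: "connected_graph (induced T X)" using tX unfolding tree_def by blast
  have "tree S'"
    unfolding S'_def tree_def
    using induced_simple[OF T'(1)] induced_acyclic[OF T'(3)] pendant_connected[OF T'(1) cX xw(1,3)]
    by blast
  moreover have "embeds S' T"
  proof -
    have "graph_embedding S' T id"
      using \<open>X \<subset> verts T\<close> adj_verts(2)[OF T'(1) xw(3)] unfolding S'_def graph_embedding_def by auto
    then show ?thesis unfolding embeds_def by blast
  qed
  moreover have "embeds T S'"
  proof -
    have "graph_embedding (induced T X) S' id" unfolding S'_def graph_embedding_def by auto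
    then have "embeds (induced T X) S'" unfolding embeds_def by blast
    then show ?thesis
      using S isomorphic_imp_embeds[OF iso] unfolding sibling_trees_def siblings_def
      by (blast intro: embeds_trans)
  qed
  ultimately have S': "S' \<in> sibling_trees T" unfolding sibling_trees_def siblings_def by blast
  obtain h where h: "bij_betw h (verts S - core S) (X - core (induced T X))"
    using isomorphic_outside_core[OF iso] by auto
  have "verts S' - core S' = insert w (X - core (induced T X))"
    using core_pendant[OF T'(1,3) cX xw(2)] xw(2) core_subset[of "induced T X"]
    unfolding S'_def by auto
  moreover have "finite (X - core (induced T X))" using bij_betw_finite[OF h] S(2) by blast
  ultimately show ?thesis using S' xw(2) bij_betw_same_card[OF h] by (intro bexI[of _ S']) auto
qed

lemma infinitely_many_siblings:
  assumes T: "tree T" "leafless T" and f: "graph_embedding T T f" "f ` verts T \<noteq> verts T"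
  shows "Sib T = \<infinity>"
proof -
  have TT: "T \<in> sibling_trees T"
    using T(1) isomorphic_imp_embeds[OF isomorphic_refl]
    unfolding sibling_trees_def siblings_def by blast
  have "\<not> (\<exists>v. verts T \<subseteq> {v})"
  proof
    assume "\<exists>v. verts T \<subseteq> {v}"
    moreover have "verts T \<noteq> {}" using T(1) unfolding tree_def connected_graph_def by blast
    ultimately obtain v where "verts T = {v}" by blast
    then show False using f unfolding graph_embedding_def by auto
  qed
  then have "verts T - core T = {}" using core_leafless[OF T] by blast
  have "\<exists>S\<in>sibling_trees T. finite (verts S - core S) \<and> card (verts S - core S) = n" for n
  proof (induction n)
    case 0
    show ?case using TT \<open>verts T - core T = {}\<close> by (metis card.empty finite.emptyI)
  next
    case (Suc n)
    then show ?case using larger_sibling[OF T(1) f] by metis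
  qed
  then obtain S where S: "\<And>n. S n \<in> sibling_trees T"
    and card: "\<And>n. card (verts (S n) - core (S n)) = n"
    by metis
  have "inj (\<lambda>n. sibling_iso T `` {S n})"
  proof (rule injI)
    fix m n assume "sibling_iso T `` {S m} = sibling_iso T `` {S n}"
    then have "(S m, S n) \<in> sibling_iso T"
      using eq_equiv_class[OF _ equiv_sibling_iso S] by blast
    then have "isomorphic (S m) (S n)" unfolding sibling_iso_def by blast
    then show "m = n" using isomorphic_outside_core bij_betw_same_card card by metis
  qed
  then have "infinite (range (\<lambda>n. sibling_iso T `` {S n}))" by (rule range_inj_infinite)
  moreover have "range (\<lambda>n. sibling_iso T `` {S n}) \<subseteq> sibling_trees T // sibling_iso T"
    using S by (auto intro: quotientI)
  ultimately have "infinite (sibling_trees T // sibling_iso T)" by (meson finite_subset)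
  then show ?thesis unfolding Sib_def by simp
qed

section \<open>Trees whose self-embeddings are all onto\<close>

lemma only_sibling:
  assumes T: "tree T" and onto: "\<And>f. graph_embedding T T f \<Longrightarrow> f ` verts T = verts T"
  shows "Sib T = 1"
proof -
  have TT: "T \<in> sibling_trees T"
    using T isomorphic_imp_embeds[OF isomorphic_refl]
    unfolding sibling_trees_def siblings_def by blast
  have "isomorphic S T" if S: "S \<in> sibling_trees T" for S
  proof -
    obtain f g where f: "graph_embedding T S f" and g: "graph_embedding S T g"
      using S unfolding sibling_trees_def siblings_def embeds_def by blast
    have "g ` f ` verts T = verts T"
      using onto[OF graph_embedding_comp[OF f g]] by (simp add: image_comp)
    moreover have "f ` verts T \<subseteq> verts S" "g ` verts S \<subseteq> verts T"
      using f g unfolding graph_embedding_def by blast+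
    ultimately have "g ` verts S = verts T" by (metis image_mono subset_antisym)
    then show ?thesis
      using onto_embedding_isomorphic[OF _ T g] S unfolding sibling_trees_def by blast
  qed
  then have "(T, S) \<in> sibling_iso T" if "S \<in> sibling_trees T" for S
    using that TT isomorphic_sym unfolding sibling_iso_def by blast
  then have "sibling_iso T `` {S} = sibling_iso T `` {T}" if "S \<in> sibling_trees T" for S
    using that equiv_class_eq[OF equiv_sibling_iso] by metis
  then have "sibling_trees T // sibling_iso T = {sibling_iso T `` {T}}"
    using TT unfolding quotient_def by blast
  then show ?thesis unfolding Sib_def by (simp add: one_enat_def)
qed

theorem theorem3p2:
  fixes T :: "'a ugraph"
  assumes "tree T" and "leafless T"
  shows "Sib T = 1 \<or> Sib T = \<infinity>"
  using infinitely_many_siblings[OF assms] only_sibling[OF assms(1)] by metis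

end
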